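(* The Fano plane $\mathbb{F}_2\mathbf{P}^2$ is homogeneous: every isomorphism between (finite) subspaces of $\mathbb{F}_2\mathbf{P}^2$ extends to an automorphism of $\mathbb{F}_2\mathbf{P}^2$.
   Context: A linear space is a pair $\langle X,\mathcal L\rangle$ where $X$ is a set (of points) and $\mathcal L$ is a family of subsets of $X$ (lines) such that every line has at least two points and any two different points lie on exactly one common line. Points are collinear if some line contains all of them. An isomorphism of linear spaces is a bijection $f$ such that any three pairwise distinct points are collinear if and only if their images are collinear. Any subset $Y\subseteq X$ is a subspace, with lines the sets $L\cap Y$ ($L\in\mathcal L$) having at least two points. $\mathbb{F}_2\mathbf P^2$ is the linear space whose points are the $1$-dimensional subspaces of $\mathbb{F}_2^3$ and whose lines are the $2$-dimensional subspaces of $\mathbb{F}_2^3$ (each identified with the set of $1$-dimensional subspaces it contains), where $\mathbb{F}_2$ is the field with $2$ elements. *)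

theory Defs
  imports "HOL-Analysis.Analysis" "HOL-Library.Z2"
begin

text \<open>A pair \<open>(X, \<L>)\<close> consists of a set of points and a set of lines.\<close>

type_synonym 'a incidence = "'a set \<times> 'a set set"

abbreviation points :: "'a incidence \<Rightarrow> 'a set" where
  "points S \<equiv> fst S"

abbreviation lines :: "'a incidence \<Rightarrow> 'a set set" where
  "lines S \<equiv> snd S"

text \<open>``At least two points'' is not stated by a cardinality, as \<^const>\<open>card\<close> is \<open>0\<close> on
  infinite sets.\<close>

definition at_least_two :: "'a set \<Rightarrow> bool" where
  "at_least_two L \<longleftrightarrow> (\<exists>x\<in>L. \<exists>y\<in>L. x \<noteq> y)"

definition linear_space :: "'a incidence \<Rightarrow> bool" where
  "linear_space S \<longleftrightarrow>
     (\<forall>L\<in>lines S. L \<subseteq> points S \<and> at_least_two L) \<and>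
     (\<forall>x\<in>points S. \<forall>y\<in>points S. x \<noteq> y \<longrightarrow> (\<exists>!L. L \<in> lines S \<and> x \<in> L \<and> y \<in> L))"

definition collinear_in :: "'a incidence \<Rightarrow> 'a set \<Rightarrow> bool" where
  "collinear_in S A \<longleftrightarrow> (\<exists>L\<in>lines S. A \<subseteq> L)"

definition linear_iso :: "('a \<Rightarrow> 'b) \<Rightarrow> 'a incidence \<Rightarrow> 'b incidence \<Rightarrow> bool" where
  "linear_iso f S T \<longleftrightarrow>
     bij_betw f (points S) (points T) \<and>
     (\<forall>x\<in>points S. \<forall>y\<in>points S. \<forall>z\<in>points S. x \<noteq> y \<and> y \<noteq> z \<and> x \<noteq> z \<longrightarrow>
        (collinear_in S {x, y, z} \<longleftrightarrow> collinear_in T {f x, f y, f z}))"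

definition subspace_on :: "'a incidence \<Rightarrow> 'a set \<Rightarrow> 'a incidence" where
  "subspace_on S Y = (Y, {L \<inter> Y | L. L \<in> lines S \<and> at_least_two (L \<inter> Y)})"

definition homogeneous :: "'a incidence \<Rightarrow> bool" where
  "homogeneous S \<longleftrightarrow>
     (\<forall>A B f. finite A \<and> A \<subseteq> points S \<and> finite B \<and> B \<subseteq> points S \<and>
        linear_iso f (subspace_on S A) (subspace_on S B) \<longrightarrow>
        (\<exists>g. linear_iso g S S \<and> (\<forall>x\<in>A. g x = f x)))"

text \<open>The type \<^typ>\<open>bit\<close> is the field with two elements, and \<^term>\<open>vec.subspace\<close>,
  \<^term>\<open>vec.dim\<close> refer to the vector space of columns over an arbitrary field.\<close>

definition fano_points :: "(bit ^ 3) set set" where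
  "fano_points = {V. vec.subspace V \<and> vec.dim V = 1}"

definition fano_lines :: "(bit ^ 3) set set set" where
  "fano_lines = {{p \<in> fano_points. p \<subseteq> W} | W. vec.subspace W \<and> vec.dim W = 2}"

definition fano_plane :: "(bit ^ 3) set incidence" where
  "fano_plane = (fano_points, fano_lines)"

lemma linear_space_subspace_on:
  assumes S: "linear_space S" and Y: "Y \<subseteq> points S"
  shows "linear_space (subspace_on S Y)"
proof -
  have ex1: "\<exists>!M. M \<in> lines (subspace_on S Y) \<and> x \<in> M \<and> y \<in> M"
    if xy: "x \<in> Y" "y \<in> Y" "x \<noteq> y" for x y
  proof -
    have "x \<in> points S" "y \<in> points S" using xy Y by blast+
    then have "\<exists>!L. L \<in> lines S \<and> x \<in> L \<and> y \<in> L"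
      using S xy(3) unfolding linear_space_def by blast
    then obtain L where L: "L \<in> lines S" "x \<in> L" "y \<in> L"
      and u: "\<And>M. M \<in> lines S \<and> x \<in> M \<and> y \<in> M \<Longrightarrow> M = L" by (elim ex1E) blast
    show ?thesis
    proof (rule ex1I[of _ "L \<inter> Y"])
      have "at_least_two (L \<inter> Y)" using L xy unfolding at_least_two_def by blast
      then show "L \<inter> Y \<in> lines (subspace_on S Y) \<and> x \<in> L \<inter> Y \<and> y \<in> L \<inter> Y"
        using L xy unfolding subspace_on_def by auto
    next
      fix M
      assume M: "M \<in> lines (subspace_on S Y) \<and> x \<in> M \<and> y \<in> M"
      then obtain K where K: "K \<in> lines S" "M = K \<inter> Y" unfolding subspace_on_def by auto
      with M have "K = L" by (intro u) blast
      with K show "M = L \<inter> Y" by simp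
    qed
  qed
  have sub: "M \<subseteq> Y \<and> at_least_two M" if "M \<in> lines (subspace_on S Y)" for M
    using that unfolding subspace_on_def by auto
  have pts: "points (subspace_on S Y) = Y" by (simp add: subspace_on_def)
  show ?thesis
    unfolding linear_space_def pts by (intro conjI[OF ballI ballI] ballI impI) (fact sub, fact ex1)
qed

lemma linear_space_fano_plane: "linear_space fano_plane"
proof -
  have point: "\<exists>v. v \<noteq> 0 \<and> p = vec.span {v}" if p: "p \<in> fano_points" for p
  proof -
    from p have s: "vec.subspace p" and d: "vec.dim p = 1"
      by (auto simp: fano_points_def)
    obtain B where B: "B \<subseteq> p" "vec.independent B" "p \<subseteq> vec.span B" "card B = vec.dim p"
      using vec.basis_exists by blast
    then obtain v where v: "B = {v}" using d card_1_singletonE by metis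
    then have "v \<noteq> 0" using B(2) vec.dependent_zero[of B] by auto
    moreover have "p = vec.span {v}"
      using B(1,3) v s vec.span_minimal[of "{v}" p] by auto
    ultimately show ?thesis by blast
  qed
  have span_point: "vec.span {v} \<in> fano_points" if "v \<noteq> 0" for v :: "bit ^ 3"
    using that by (simp add: fano_points_def vec.dim_eq_card_independent)
  have two: "\<exists>x\<in>L. \<exists>y\<in>L. x \<noteq> y" if "L \<in> fano_lines" for L
  proof -
    from that obtain W where W: "vec.subspace W" "vec.dim W = 2"
      and L: "L = {p \<in> fano_points. p \<subseteq> W}" by (auto simp: fano_lines_def)
    obtain B where B: "B \<subseteq> W" "vec.independent B" "card B = 2"
      using vec.basis_exists W by metis
    then obtain v w where vw: "B = {v, w}" "v \<noteq> w" by (auto simp: card_2_iff)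
    have nz: "v \<noteq> 0" "w \<noteq> 0" using B(2) vw(1) vec.dependent_zero[of B] by auto
    have "v \<notin> vec.span {w}" using B(2) vw by (simp add: vec.independent_insert)
    then have "vec.span {v} \<noteq> vec.span {w}" using vec.span_base[of v "{v}"] by auto
    moreover have "vec.span {v} \<subseteq> W" "vec.span {w} \<subseteq> W"
      using B(1) vw(1) W(1) vec.span_minimal[of "{v}" W] vec.span_minimal[of "{w}" W] by simp_all
    ultimately show ?thesis using L nz span_point by blast
  qed
  have sub: "L \<subseteq> fano_points" if "L \<in> fano_lines" for L
    using that unfolding fano_lines_def by blast
  have ex1: "\<exists>!L. L \<in> fano_lines \<and> p \<in> L \<and> q \<in> L"
    if pq: "p \<in> fano_points" "q \<in> fano_points" "p \<noteq> q" for p q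
  proof -
    obtain v w where v: "v \<noteq> 0" "p = vec.span {v}" and w: "w \<noteq> 0" "q = vec.span {w}"
      using point pq by meson
    have vw: "v \<noteq> w" using v w pq by blast
    have nin: "v \<notin> vec.span {w}"
    proof
      assume h: "v \<in> vec.span {w}"
      then have "p \<subseteq> q" using v w by (simp add: vec.span_minimal)
      moreover have "vec.dim q \<le> vec.dim p" using pq by (simp add: fano_points_def)
      ultimately have "p = q"
        using pq vec.subspace_dim_equal unfolding fano_points_def by blast
      with pq show False by simp
    qed
    have ind: "vec.independent {v, w}"
      using nin w by (simp add: vec.independent_insert)
    let ?W = "vec.span {v, w}"
    have dW: "vec.dim ?W = 2"
      using ind vw vec.dim_span_eq_card_independent[of "{v, w}"] by simp
    have uniq: "W = ?W" if W: "vec.subspace W" "vec.dim W = 2" "p \<subseteq> W" "q \<subseteq> W" for W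
    proof -
      have "v \<in> W" "w \<in> W"
        using W(3,4) v(2) w(2) vec.span_base[of v "{v}"] vec.span_base[of w "{w}"] by auto
      then have "?W \<subseteq> W" using W(1) vec.span_minimal[of "{v, w}" W] by simp
      then show ?thesis
        using vec.subspace_dim_equal[of ?W W] W dW by (simp add: vec.subspace_span)
    qed
    have "p \<subseteq> ?W" "q \<subseteq> ?W"
      using v(2) w(2) vec.span_mono[of "{v}" "{v, w}"] vec.span_mono[of "{w}" "{v, w}"] by simp_all
    moreover have "{r \<in> fano_points. r \<subseteq> ?W} \<in> fano_lines"
      unfolding fano_lines_def using dW vec.subspace_span[of "{v, w}"] by blast
    moreover have "L = {r \<in> fano_points. r \<subseteq> ?W}" if L: "L \<in> fano_lines" "p \<in> L" "q \<in> L" for L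
    proof -
      obtain W where W: "vec.subspace W" "vec.dim W = 2" and LW: "L = {r \<in> fano_points. r \<subseteq> W}"
        using L(1) unfolding fano_lines_def by blast
      then have "W = ?W" using L(2,3) by (intro uniq) simp_all
      then show ?thesis using LW by simp
    qed
    ultimately show ?thesis
      using pq(1,2) by (intro ex1I[of _ "{r \<in> fano_points. r \<subseteq> ?W}"]) blast+
  qed
  show ?thesis
    unfolding linear_space_def fano_plane_def at_least_two_def
    using two ex1 sub by simp
qed

end

theory Submission
  imports Defs
begin

text \<open>A point of the Fano plane is \<open>{0, v}\<close> for a unique nonzero vector \<open>v\<close> over the field with two
  elements, and three distinct points are collinear iff their vectors sum to zero.  An isomorphism
  between subspaces is therefore an injection \<open>h\<close> from a set \<open>A\<close> of nonzero vectors to nonzero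
  vectors that preserves and reflects zero sums of three elements.

  Over the field with two elements a linear relation among vectors is just a finite subset with zero
  sum, so the aim is that \<open>h\<close> respects zero sums of larger subsets as well.  In dimension three a basis
  has at most three elements, so an element outside a basis \<open>B \<subseteq> A\<close> of the span of \<open>A\<close> is tied to
  \<open>B\<close> by a zero sum of at most four elements.  One or two distinct nonzero vectors never sum to zero,
  and triples are the hypothesis on \<open>h\<close>.  The heart of the matter is \<open>four_sum_eq_0_iff\<close>: whether four
  points sum to zero is determined by collinearity of triples alone.  Hence \<open>h\<close> maps \<open>B\<close> to an
  independent set, the linear automorphism extending \<open>h\<close> on \<open>B\<close> agrees with \<open>h\<close> on all of \<open>A\<close>
  (\<open>linear_extension\<close>), and it induces the required automorphism of the plane.\<close>

section \<open>Linear relations over the field with two elements\<close>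

lemma bit_vec_add_self: "v + v = 0" for v :: "bit ^ 'n"
  by (simp add: vec_eq_iff)

lemma bit_vec_add_eq_0_iff: "u + v = 0 \<longleftrightarrow> u = v" for u v :: "bit ^ 'n"
  by (metis add_left_cancel bit_vec_add_self)

text \<open>A scalar is \<open>0\<close> or \<open>1\<close>, so a linear combination merely selects a subset.\<close>

lemma bit_span_eq_subset_sums:
  fixes B :: "(bit ^ 'n) set"
  assumes "finite B"
  shows "vec.span B = {\<Sum>D | D. D \<subseteq> B}"
proof (intro equalityI subsetI)
  fix x assume "x \<in> vec.span B"
  then obtain c where c: "x = (\<Sum>v\<in>B. c v *s v)"
    using vec.span_finite[OF assms] by auto
  have "c v *s v = (if c v = 1 then v else 0)" for v
    by (cases "c v = 1") simp_all
  then have "x = \<Sum>{v \<in> B. c v = 1}"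
    using assms by (simp add: c sum.inter_filter)
  then show "x \<in> {\<Sum>D | D. D \<subseteq> B}" by blast
next
  fix x assume "x \<in> {\<Sum>D | D. D \<subseteq> B}"
  then show "x \<in> vec.span B"
    using vec.span_base by (auto intro!: vec.span_sum)
qed

lemma bit_independent_iff_subset_sums:
  fixes B :: "(bit ^ 'n) set"
  assumes fin: "finite B"
  shows "vec.independent B \<longleftrightarrow> (\<forall>D\<subseteq>B. \<Sum>D = 0 \<longrightarrow> D = {})"
proof
  assume ind: "vec.independent B"
  show "\<forall>D\<subseteq>B. \<Sum>D = 0 \<longrightarrow> D = {}"
  proof (intro allI impI, rule ccontr)
    fix D assume D: "D \<subseteq> B" "\<Sum>D = 0" "D \<noteq> {}"
    then obtain d where d: "d \<in> D" by blast
    have "finite D" using D(1) fin finite_subset by blast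
    then have "d + \<Sum>(D - {d}) = 0" using D(2) d by (simp add: sum.remove)
    then have "d = \<Sum>(D - {d})" by (simp add: bit_vec_add_eq_0_iff)
    moreover have "\<Sum>(D - {d}) \<in> vec.span (B - {d})"
      using D(1) by (intro vec.span_sum vec.span_base) blast
    ultimately show False using ind d D(1) unfolding vec.dependent_def by (metis subsetD)
  qed
next
  assume R: "\<forall>D\<subseteq>B. \<Sum>D = 0 \<longrightarrow> D = {}"
  show "vec.independent B"
    unfolding vec.dependent_def
  proof
    assume "\<exists>a\<in>B. a \<in> vec.span (B - {a})"
    then obtain a D where a: "a \<in> B" "D \<subseteq> B - {a}" "a = \<Sum>D"
      using fin by (auto simp: bit_span_eq_subset_sums)
    have aD: "a \<notin> D" and sub: "insert a D \<subseteq> B" using a(1,2) by blast+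
    have "finite D" using a(2) by (rule finite_subset) (simp add: fin)
    then have "\<Sum>(insert a D) = a + \<Sum>D" using aD by (rule sum.insert)
    also have "\<dots> = 0" unfolding a(3)[symmetric] by (rule bit_vec_add_self)
    finally show False using R sub by blast
  qed
qed

lemma sum_eq_0_iff_card_le_2:
  fixes D :: "(bit ^ 'n) set"
  assumes "finite D" "card D \<le> 2" "0 \<notin> D"
  shows "\<Sum>D = 0 \<longleftrightarrow> D = {}"
proof -
  consider "card D = 0" | "card D = 1" | "card D = 2" using assms(2) by linarith
  then show ?thesis
  proof cases
    case 1 then show ?thesis using assms by simp
  next
    case 2 then show ?thesis using assms by (auto simp: card_1_singleton_iff)
  next
    case 3 then show ?thesis by (auto simp: card_2_iff bit_vec_add_eq_0_iff)
  qed
qed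

lemma independent_card_3_iff:
  fixes T :: "(bit ^ 'n) set"
  assumes T: "card T = 3" "0 \<notin> T"
  shows "vec.independent T \<longleftrightarrow> \<Sum>T \<noteq> 0"
proof -
  have fin: "finite T" using T(1) by (intro card_ge_0_finite) simp
  have proper: "\<Sum>D = 0 \<longrightarrow> D = {}" if D: "D \<subseteq> T" "D \<noteq> T" for D
  proof -
    have "card D < 3" using psubset_card_mono[OF fin, of D] D T(1) by (simp add: psubset_eq)
    then have "card D \<le> 2" by simp
    moreover have "finite D" using D(1) fin by (rule finite_subset)
    moreover have "0 \<notin> D" using D(1) T(2) by blast
    ultimately show ?thesis by (simp add: sum_eq_0_iff_card_le_2)
  qed
  have "T \<noteq> {}" using T(1) by (intro notI) simp
  then have "(\<forall>D\<subseteq>T. \<Sum>D = 0 \<longrightarrow> D = {}) \<longleftrightarrow> \<Sum>T \<noteq> 0"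
    using proper by (metis subset_refl)
  then show ?thesis unfolding bit_independent_iff_subset_sums[OF fin] .
qed

section \<open>Zero sums in dimension three\<close>

text \<open>If no three of the four points are collinear, then three of them form a triangle whose sides
  cover six of the seven points.  The fourth point must be the remaining one, which is the sum of
  the three vertices.  Conversely, if four vectors and three of them sum to zero, the fourth is zero.\<close>

lemma four_sum_eq_0_iff:
  fixes D :: "(bit ^ 3) set"
  assumes D: "card D = 4" "0 \<notin> D"
  shows "\<Sum>D = 0 \<longleftrightarrow> (\<forall>T\<subseteq>D. card T = 3 \<longrightarrow> \<Sum>T \<noteq> 0)"
proof
  have fin: "finite D" using D(1) by (intro card_ge_0_finite) simp
  show "\<forall>T\<subseteq>D. card T = 3 \<longrightarrow> \<Sum>T \<noteq> 0" if z: "\<Sum>D = 0"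
  proof (intro allI impI notI)
    fix T assume T: "T \<subseteq> D" "card T = 3" "\<Sum>T = 0"
    have "card (D - T) = 1" using T D(1) fin by (simp add: card_Diff_subset finite_subset)
    then obtain d where d: "D - T = {d}" by (auto simp: card_1_singleton_iff)
    have "\<Sum>D = \<Sum>(D - T) + \<Sum>T" using T(1) fin by (rule sum.subset_diff)
    then have "d = 0" using d z T(3) by simp
    then show False using d D(2) by blast
  qed
  assume R: "\<forall>T\<subseteq>D. card T = 3 \<longrightarrow> \<Sum>T \<noteq> 0"
  obtain d where d: "d \<in> D" using D(1) by (metis card.empty ex_in_conv zero_neq_numeral)
  define T where "T = D - {d}"
  have T: "card T = 3" "0 \<notin> T" "T \<subseteq> D" "finite T" "d \<notin> T"
    using D d fin by (auto simp: T_def)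
  have "vec.independent T" using independent_card_3_iff[OF T(1,2)] R T(1,3) by blast
  \<comment> \<open>The other three vectors form a basis, so \<open>d\<close> is the sum of some of them.  Fewer than three
    summands would give a zero sum of at most three elements of \<open>D\<close>.\<close>
  moreover have "vec.dim (UNIV :: (bit ^ 3) set) \<le> card T"
    unfolding T(1) vec_dim_card by simp
  ultimately have "UNIV \<subseteq> vec.span T" by (rule vec.card_ge_dim_independent[OF subset_UNIV])
  then have "d \<in> vec.span T" by blast
  then obtain U where U: "U \<subseteq> T" "d = \<Sum>U"
    unfolding bit_span_eq_subset_sums[OF T(4)] by blast
  have finU: "finite U" using U(1) T(4) by (rule finite_subset)
  have dU: "d \<notin> U" using U(1) T(5) by blast
  have z: "\<Sum>(insert d U) = 0"
    using finU dU U(2)[symmetric] by (simp add: bit_vec_add_self)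
  have sub: "insert d U \<subseteq> D" using U(1) T(3) d by blast
  have c: "card (insert d U) = Suc (card U)" using finU dU by simp
  have "card U \<noteq> 2" using R[rule_format, OF sub] z c by force
  moreover have "\<not> card U \<le> 1"
  proof
    assume "card U \<le> 1"
    then have "insert d U = {}"
      by (subst sum_eq_0_iff_card_le_2[symmetric]) (use z c finU sub D(2) in auto)
    then show False by blast
  qed
  moreover have "card U \<le> 3" using card_mono[OF T(4) U(1)] T(1) by simp
  ultimately have "card U = card T" using T(1) by linarith
  then have "U = T" by (rule card_subset_eq[OF T(4) U(1)])
  then have "insert d U = D" using d by (simp only: T_def insert_Diff)
  then show "\<Sum>D = 0" using z by simp
qed

text \<open>A zero sum of four elements is expressed by \<open>four_sum_eq_0_iff\<close> through its triples, both for
  \<open>D\<close> and for its image, so the condition on triples carries it over.\<close>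

lemma zero_sum_transfer:
  fixes h :: "bit ^ 3 \<Rightarrow> bit ^ 3"
  assumes inj: "inj_on h A" and nz: "0 \<notin> A" "0 \<notin> h ` A"
    and triple: "\<And>T. T \<subseteq> A \<Longrightarrow> card T = 3 \<Longrightarrow> \<Sum>T = 0 \<longleftrightarrow> \<Sum>(h ` T) = 0"
    and D: "D \<subseteq> A" "finite D" "card D \<le> 4"
  shows "\<Sum>D = 0 \<longleftrightarrow> \<Sum>(h ` D) = 0"
proof -
  have card: "card (h ` T) = card T" if "T \<subseteq> D" for T
    by (rule card_image, rule inj_on_subset[OF inj subset_trans[OF that D(1)]])
  have nzD: "0 \<notin> D" "0 \<notin> h ` D" using nz D(1) by auto
  consider "card D \<le> 2" | "card D = 3" | "card D = 4" using D(3) by linarith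
  then show ?thesis
  proof cases
    case 1
    moreover have "card (h ` D) \<le> 2" using 1 card[OF subset_refl] by simp
    ultimately show ?thesis
      using sum_eq_0_iff_card_le_2[OF D(2) _ nzD(1)]
        sum_eq_0_iff_card_le_2[OF finite_imageI[OF D(2)] _ nzD(2)] by simp
  next
    case 2
    then show ?thesis using triple D(1) by blast
  next
    case 3
    have "(card (h ` T) = 3 \<longrightarrow> \<Sum>(h ` T) \<noteq> 0) \<longleftrightarrow> (card T = 3 \<longrightarrow> \<Sum>T \<noteq> 0)"
      if "T \<subseteq> D" for T
      unfolding card[OF that] using triple[OF subset_trans[OF that D(1)]] by argo
    then have "(\<forall>T\<subseteq>h ` D. card T = 3 \<longrightarrow> \<Sum>T \<noteq> 0) \<longleftrightarrow> (\<forall>T\<subseteq>D. card T = 3 \<longrightarrow> \<Sum>T \<noteq> 0)"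
      unfolding all_subset_image by simp
    moreover have "card (h ` D) = 4" using 3 card[OF subset_refl] by simp
    ultimately show ?thesis
      by (simp only: four_sum_eq_0_iff[OF 3 nzD(1)] four_sum_eq_0_iff[OF _ nzD(2)])
  qed
qed

text \<open>The linear extension of \<open>h\<close> from a basis \<open>B \<subseteq> A\<close> of the span of \<open>A\<close> has to agree with \<open>h\<close> at
  the other elements of \<open>A\<close> too.  Such an \<open>x\<close> is the sum of some \<open>D \<subseteq> B\<close>, which is the zero sum of
  \<open>insert x D\<close>; as \<open>h\<close> preserves it, \<open>h x\<close> is the sum of the images of \<open>D\<close>.\<close>

lemma linear_extension:
  fixes h :: "bit ^ 3 \<Rightarrow> bit ^ 3"
  assumes inj: "inj_on h A" and nz: "0 \<notin> A" "0 \<notin> h ` A"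
    and triple: "\<And>T. T \<subseteq> A \<Longrightarrow> card T = 3 \<Longrightarrow> \<Sum>T = 0 \<longleftrightarrow> \<Sum>(h ` T) = 0"
  shows "\<exists>g. Vector_Spaces.linear (*s) (*s) g \<and> inj g \<and> (\<forall>x\<in>A. g x = h x)"
proof -
  have transfer: "\<Sum>D = 0 \<longleftrightarrow> \<Sum>(h ` D) = 0" if "D \<subseteq> A" "finite D" "card D \<le> 4" for D
    using inj nz triple that by (rule zero_sum_transfer)
  obtain B where B: "B \<subseteq> A" "vec.independent B" "A \<subseteq> vec.span B"
    using vec.maximal_independent_subset by blast
  have finB: "finite B" using B(2) vec.finiteI_independent by blast
  have cardB: "card B \<le> 3"
    using vec.independent_card_le_dim[OF subset_UNIV B(2)] unfolding vec_dim_card by simp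
  have injB: "inj_on h B" using inj B(1) inj_on_subset by blast
  have "vec.independent (h ` B)"
    unfolding bit_independent_iff_subset_sums[OF finite_imageI[OF finB]] all_subset_image
  proof (intro allI impI)
    fix D assume D: "D \<subseteq> B" "\<Sum>(h ` D) = 0"
    have "finite D" "card D \<le> 4" using D(1) finB cardB card_mono[of B D] finite_subset by auto
    then have "\<Sum>D = 0" using transfer[of D] D B(1) by blast
    then show "h ` D = {}" using B(2) D(1) finB by (auto simp: bit_independent_iff_subset_sums)
  qed
  then obtain g where g: "Vector_Spaces.linear (*s) (*s) g" "inj g" "\<And>x. x \<in> B \<Longrightarrow> g x = h x"
    using vec.linear_independent_extend_inj[OF B(2) _ injB] by blast
  have "g x = h x" if x: "x \<in> A" for x
  proof (cases "x \<in> B")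
    case False
    obtain D where D: "D \<subseteq> B" "x = \<Sum>D"
      using B(3) x finB by (auto simp: bit_span_eq_subset_sums)
    have finD: "finite D" and xD: "x \<notin> D" using D(1) finB False finite_subset by auto
    have sub: "insert x D \<subseteq> A" using D(1) B(1) x by blast
    have "card (insert x D) \<le> 4"
      using D(1) finB cardB card_mono[of B D] finD xD by simp
    moreover have "\<Sum>(insert x D) = 0"
      using finD xD D(2)[symmetric] by (simp add: bit_vec_add_self)
    ultimately have "\<Sum>(h ` insert x D) = 0" using transfer[OF sub] finD by blast
    also have "\<Sum>(h ` insert x D) = (\<Sum>y\<in>insert x D. h y)"
      using sum.reindex[OF inj_on_subset[OF inj sub], of "\<lambda>y. y"] unfolding comp_def .
    also have "\<dots> = h x + (\<Sum>y\<in>D. h y)" using finD xD by simp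
    also have "(\<Sum>y\<in>D. h y) = (\<Sum>y\<in>D. g y)" using D(1) g(3) by (intro sum.cong) auto
    also have "\<dots> = g x" unfolding D(2) using g(1) by (simp add: vec.linear_sum)
    finally show ?thesis by (simp add: bit_vec_add_eq_0_iff)
  qed (use g(3) in simp)
  then show ?thesis using g by blast
qed

section \<open>Coordinates on the Fano plane\<close>

lemma bit_span_singleton: "vec.span {v} = {0, v}" for v :: "bit ^ 'n"
proof -
  have "vec.span {v} = Sum ` Pow {v}"
    by (auto simp: bit_span_eq_subset_sums)
  then show ?thesis by (simp add: Pow_insert insert_commute)
qed

lemma bij_betw_span_fano_points: "bij_betw (\<lambda>v. vec.span {v}) (- {0}) fano_points"
  unfolding bij_betw_def
proof (intro conjI equalityI subsetI)
  show "inj_on (\<lambda>v. vec.span {v}) (- {0 :: bit ^ 3})"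
    by (auto simp: inj_on_def bit_span_singleton)
next
  fix p :: "(bit ^ 3) set" assume "p \<in> (\<lambda>v. vec.span {v}) ` (- {0})"
  then show "p \<in> fano_points"
    by (auto simp: fano_points_def vec.dim_eq_card_independent)
next
  fix p assume "p \<in> fano_points"
  then have s: "vec.subspace p" and d: "vec.dim p = 1" by (auto simp: fano_points_def)
  obtain B where B: "B \<subseteq> p" "vec.independent B" "p \<subseteq> vec.span B" "card B = vec.dim p"
    using vec.basis_exists by blast
  then obtain v where v: "B = {v}" using d card_1_singletonE by metis
  then have "v \<noteq> 0" using B(2) vec.dependent_zero[of B] by auto
  moreover have "p = vec.span {v}" using B(1,3) v s vec.span_minimal[of "{v}" p] by auto
  ultimately show "p \<in> (\<lambda>v. vec.span {v}) ` (- {0})" by blast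
qed

text \<open>Three distinct points lie on a line iff their vectors are dependent, and the only relation
  possible among three distinct nonzero vectors is that all of them sum to zero.\<close>

lemma collinear_fano_iff_sum_eq_0:
  assumes nz: "u \<noteq> 0" "v \<noteq> 0" "w \<noteq> 0" and ne: "u \<noteq> v" "v \<noteq> w" "u \<noteq> w"
  shows "collinear_in fano_plane {vec.span {u}, vec.span {v}, vec.span {w}} \<longleftrightarrow> u + v + w = 0"
proof -
  have pts: "vec.span {u} \<in> fano_points" "vec.span {v} \<in> fano_points" "vec.span {w} \<in> fano_points"
    using nz bij_betw_span_fano_points by (auto dest: bij_betwE)
  have sub: "vec.span {x} \<subseteq> W \<longleftrightarrow> x \<in> W" if "vec.subspace W" for x and W :: "(bit ^ 3) set"
    using that vec.span_base[of x "{x}"] vec.span_minimal[of "{x}" W] by auto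
  have "collinear_in fano_plane {vec.span {u}, vec.span {v}, vec.span {w}} \<longleftrightarrow>
      (\<exists>W. (vec.subspace W \<and> vec.dim W = 2) \<and>
        {vec.span {u}, vec.span {v}, vec.span {w}} \<subseteq> {p \<in> fano_points. p \<subseteq> W})"
    unfolding collinear_in_def fano_plane_def fano_lines_def snd_conv by blast
  also have "\<dots> \<longleftrightarrow> (\<exists>W. vec.subspace W \<and> vec.dim W = 2 \<and> {u, v, w} \<subseteq> W)"
    using pts sub by (intro ex_cong1) auto
  also have "\<dots> \<longleftrightarrow> u + v + w = 0"
  proof
    assume "\<exists>W. vec.subspace W \<and> vec.dim W = 2 \<and> {u, v, w} \<subseteq> W"
    then obtain W where W: "vec.dim W = 2" "{u, v, w} \<subseteq> W" by blast
    then have "\<not> vec.independent {u, v, w}"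
      using vec.independent_card_le_dim[OF W(2)] ne by auto
    then show "u + v + w = 0"
      using independent_card_3_iff[of "{u, v, w}"] nz ne by (simp add: add.assoc)
  next
    assume z: "u + v + w = 0"
    have "vec.independent {u, v}"
      using nz ne(1) by (auto simp: vec.independent_insert bit_span_singleton)
    then have "vec.dim (vec.span {u, v}) = 2"
      using ne(1) vec.dim_span_eq_card_independent[of "{u, v}"] by simp
    moreover have "w = u + v" using z by (simp add: bit_vec_add_eq_0_iff)
    then have "{u, v, w} \<subseteq> vec.span {u, v}"
      by (simp add: vec.span_base vec.span_add)
    ultimately show "\<exists>W. vec.subspace W \<and> vec.dim W = 2 \<and> {u, v, w} \<subseteq> W"
      using vec.subspace_span by blast
  qed
  finally show ?thesis .
qed

text \<open>With at least two points in \<open>T\<close>, the trace on \<open>Y\<close> of a line through \<open>T\<close> is a line of the subspace.\<close>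

lemma collinear_in_subspace_on:
  assumes "T \<subseteq> Y" "at_least_two T"
  shows "collinear_in (subspace_on S Y) T \<longleftrightarrow> collinear_in S T"
proof -
  have "at_least_two (L \<inter> Y)" if "T \<subseteq> L" for L
    using assms that unfolding at_least_two_def by blast
  then show ?thesis
    using assms(1) by (auto simp: collinear_in_def subspace_on_def)
qed

lemma linear_imp_collineation:
  assumes lin: "Vector_Spaces.linear (*s) (*s) g" and inj: "inj g"
  shows "linear_iso ((`) g) fano_plane fano_plane"
proof -
  have bij: "bij g" using vec.linear_inj_imp_surj[OF lin inj] inj by (simp add: bij_def)
  have g0: "g 0 = 0" using lin by (rule vec.linear_0)
  have gz: "g v = 0 \<longleftrightarrow> v = 0" for v using inj g0 by (metis injD)
  have im: "g ` vec.span {v} = vec.span {g v}" for v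
    by (simp add: bit_span_singleton g0)
  note span_bij = bij_betw_span_fano_points
  have fp: "fano_points = (\<lambda>v. vec.span {v}) ` (- {0})"
    using span_bij by (simp add: bij_betw_def)
  have surj: "g ` (- {0}) = - {0}"
    using bij by (simp add: bij_image_Compl_eq g0)
  have "(`) g ` fano_points = (\<lambda>v. vec.span {v}) ` g ` (- {0})"
    unfolding fp image_image im ..
  then have "(`) g ` fano_points = fano_points" unfolding surj fp .
  moreover have "inj_on ((`) g) fano_points"
    using inj by (simp add: inj_on_def inj_image_eq_iff)
  ultimately have b: "bij_betw ((`) g) fano_points fano_points" by (simp add: bij_betw_def)
  have "collinear_in fano_plane {x, y, z} \<longleftrightarrow> collinear_in fano_plane {g ` x, g ` y, g ` z}"
    if pts: "x \<in> fano_points" "y \<in> fano_points" "z \<in> fano_points"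
      and ne: "x \<noteq> y" "y \<noteq> z" "x \<noteq> z" for x y z
  proof -
    obtain u v w where uvw: "x = vec.span {u}" "y = vec.span {v}" "z = vec.span {w}"
      and nz: "u \<noteq> 0" "v \<noteq> 0" "w \<noteq> 0" using pts unfolding fp by auto
    have "g u + g v + g w = g (u + v + w)" by (simp add: vec.linear_add[OF lin])
    then have "g u + g v + g w = 0 \<longleftrightarrow> u + v + w = 0" by (simp add: gz)
    moreover have "u \<noteq> v" "v \<noteq> w" "u \<noteq> w" using uvw ne by auto
    ultimately show ?thesis
      using nz unfolding uvw im
      by (subst (1 2) collinear_fano_iff_sum_eq_0) (auto simp: gz inj_eq[OF inj])
  qed
  then show ?thesis
    using b by (simp add: linear_iso_def fano_plane_def)
qed

section \<open>Homogeneity\<close>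

theorem corollary3p4:
  shows "homogeneous fano_plane"
  unfolding homogeneous_def
proof (intro allI impI, elim conjE)
  fix A B f
  assume A: "A \<subseteq> points fano_plane" and B: "B \<subseteq> points fano_plane"
    and iso: "linear_iso f (subspace_on fano_plane A) (subspace_on fano_plane B)"
  let ?P = "\<lambda>v :: bit ^ 3. vec.span {v}"
  \<comment> \<open>\<open>h\<close> is \<open>f\<close> read off on the nonzero vectors of the points.\<close>
  define V where "V = {v. v \<noteq> 0 \<and> ?P v \<in> A}"
  define h where "h = (\<lambda>v. inv_into (- {0}) ?P (f (?P v)))"
  have P: "inj_on ?P (- {0})" "?P ` (- {0}) = fano_points"
    using bij_betw_span_fano_points by (auto simp: bij_betw_def)
  have AB: "A \<subseteq> fano_points" "B \<subseteq> fano_points" using A B by (auto simp: fano_plane_def)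
  have bij: "bij_betw f A B"
    using iso by (simp add: linear_iso_def subspace_on_def)
  have fB: "f (?P v) \<in> ?P ` (- {0})" if "v \<in> V" for v
    using that bij AB(2) unfolding V_def P(2) by (auto dest: bij_betwE)
  have Ph: "?P (h v) = f (?P v)" and h0: "h v \<noteq> 0" if "v \<in> V" for v
    using f_inv_into_f[OF fB[OF that]] inv_into_into[OF fB[OF that]] by (simp_all add: h_def)
  have injh: "inj_on h V"
  proof (rule inj_onI)
    fix u v assume uv: "u \<in> V" "v \<in> V" "h u = h v"
    then have "f (?P u) = f (?P v)" using Ph by metis
    then have "?P u = ?P v" using uv bij by (auto simp: V_def bij_betw_def inj_on_def)
    then show "u = v" using uv P(1) by (auto simp: V_def inj_on_def)
  qed
  have triple: "\<Sum>T = 0 \<longleftrightarrow> \<Sum>(h ` T) = 0" if T: "T \<subseteq> V" "card T = 3" for T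
  proof -
    obtain u v w where T_eq: "T = {u, v, w}" and ne: "u \<noteq> v" "v \<noteq> w" "u \<noteq> w"
      using T(2) by (auto simp: card_3_iff)
    have V: "u \<in> V" "v \<in> V" "w \<in> V" using T(1) T_eq by auto
    then have nz: "u \<noteq> 0" "v \<noteq> 0" "w \<noteq> 0" and inA: "?P u \<in> A" "?P v \<in> A" "?P w \<in> A"
      by (auto simp: V_def)
    have neP: "?P u \<noteq> ?P v" "?P v \<noteq> ?P w" "?P u \<noteq> ?P w"
      using P(1) nz ne by (auto simp: inj_on_def)
    have neh: "h u \<noteq> h v" "h v \<noteq> h w" "h u \<noteq> h w"
      using injh V ne by (auto simp: inj_on_def)
    have inB: "f (?P u) \<in> B" "f (?P v) \<in> B" "f (?P w) \<in> B"
      using inA bij by (auto dest: bij_betwE)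
    have nef: "f (?P u) \<noteq> f (?P v)"
      using bij inA neP(1) by (auto simp: bij_betw_def inj_on_def)
    have "\<Sum>T = 0 \<longleftrightarrow> u + v + w = 0" using ne T_eq by (simp add: add.assoc)
    also have "\<dots> \<longleftrightarrow> collinear_in fano_plane {?P u, ?P v, ?P w}"
      using nz ne by (rule collinear_fano_iff_sum_eq_0[symmetric])
    also have "\<dots> \<longleftrightarrow> collinear_in (subspace_on fano_plane A) {?P u, ?P v, ?P w}"
      using inA neP(1) by (intro collinear_in_subspace_on[symmetric]) (auto simp: at_least_two_def)
    also have "\<dots> \<longleftrightarrow> collinear_in (subspace_on fano_plane B) {f (?P u), f (?P v), f (?P w)}"
      using iso inA neP by (simp add: linear_iso_def subspace_on_def)
    also have "\<dots> \<longleftrightarrow> collinear_in fano_plane {f (?P u), f (?P v), f (?P w)}"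
      using inB nef by (intro collinear_in_subspace_on) (auto simp: at_least_two_def)
    also have "\<dots> \<longleftrightarrow> h u + h v + h w = 0"
      unfolding Ph[OF V(1), symmetric] Ph[OF V(2), symmetric] Ph[OF V(3), symmetric]
      using h0 V neh by (intro collinear_fano_iff_sum_eq_0) auto
    also have "\<dots> \<longleftrightarrow> \<Sum>(h ` T) = 0" using neh T_eq by (simp add: add.assoc)
    finally show ?thesis .
  qed
  have "0 \<notin> V" "0 \<notin> h ` V" using h0 by (force simp: V_def)+
  then obtain g where g: "Vector_Spaces.linear (*s) (*s) g" "inj g" "\<And>v. v \<in> V \<Longrightarrow> g v = h v"
    using linear_extension[OF injh, OF _ _ triple] by blast
  have "g ` p = f p" if p: "p \<in> A" for p
  proof -
    obtain v where v: "v \<noteq> 0" "p = ?P v" using p AB(1) P(2) by blast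
    then have vV: "v \<in> V" using p by (simp add: V_def)
    have "g ` ?P v = ?P (g v)"
      using vec.linear_0[OF g(1)] by (simp add: bit_span_singleton)
    then show ?thesis using v(2) g(3)[OF vV] Ph[OF vV] by simp
  qed
  then show "\<exists>g. linear_iso g fano_plane fano_plane \<and> (\<forall>x\<in>A. g x = f x)"
    using linear_imp_collineation[OF g(1,2)] by blast
qed

end
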